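(* Let $(X,\tau,\mathcal{P})$ be a primal topological space. Then the operator $cl^{\diamond}_R: 2^X\rightarrow 2^X$ defined by $cl^{\diamond}_R(A)=A\cup A^{\diamond}_R$ for every $A\subseteq X$ is a Kuratowski closure operator.
   Context: A primal on a nonempty set $X$ is a collection $\mathcal{P}\subseteq 2^X$ such that: $X\notin\mathcal{P}$; if $A\in\mathcal{P}$ and $B\subseteq A$, then $B\in\mathcal{P}$; if $A\cap B\in\mathcal{P}$, then $A\in\mathcal{P}$ or $B\in\mathcal{P}$. (The empty collection is allowed.) A primal topological space $(X,\tau,\mathcal{P})$ is a topological space $(X,\tau)$ with a primal $\mathcal{P}$ on $X$. $A^c$ denotes $X\setminus A$. A set $U\subseteq X$ is regular open if $U=int(cl(U))$; $RO(X,x)$ is the family of regular open sets containing the point $x$. For $A\subseteq X$, $A^{\diamond}_R=\{x\in X : A^c\cup U^c\in\mathcal{P}\text{ for all }U\in RO(X,x)\}$. A Kuratowski closure operator on $X$ is a map $c:2^X\to 2^X$ with $c(\emptyset)=\emptyset$, $A\subseteq c(A)$, $c(A\cup B)=c(A)\cup c(B)$ and $c(c(A))=c(A)$ for all $A,B\subseteq X$. *)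

theory Defs
  imports "HOL-Analysis.Abstract_Topology" "HOL-Library.FuncSet"
begin

definition primal_on :: "'a set \<Rightarrow> 'a set set \<Rightarrow> bool" where
  "primal_on X P \<longleftrightarrow>
     X \<noteq> {} \<and> P \<subseteq> Pow X \<and> X \<notin> P \<and>
     (\<forall>A B. A \<in> P \<and> B \<subseteq> A \<longrightarrow> B \<in> P) \<and>
     (\<forall>A B. A \<subseteq> X \<and> B \<subseteq> X \<and> A \<inter> B \<in> P \<longrightarrow> A \<in> P \<or> B \<in> P)"

definition primal_topological_space :: "'a topology \<Rightarrow> 'a set set \<Rightarrow> bool" where
  "primal_topological_space T P \<longleftrightarrow> primal_on (topspace T) P"

definition regular_openin :: "'a topology \<Rightarrow> 'a set \<Rightarrow> bool" where
  "regular_openin T U \<longleftrightarrow>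
     U \<subseteq> topspace T \<and> U = T interior_of (T closure_of U)"

definition RO_at :: "'a topology \<Rightarrow> 'a \<Rightarrow> 'a set set" where
  "RO_at T x = {U. regular_openin T U \<and> x \<in> U}"

definition diamond_R :: "'a topology \<Rightarrow> 'a set set \<Rightarrow> 'a set \<Rightarrow> 'a set" where
  "diamond_R T P A =
     {x \<in> topspace T. \<forall>U \<in> RO_at T x. (topspace T - A) \<union> (topspace T - U) \<in> P}"

definition cl_diamond_R :: "'a topology \<Rightarrow> 'a set set \<Rightarrow> 'a set \<Rightarrow> 'a set" where
  "cl_diamond_R T P A = A \<union> diamond_R T P A"

definition kuratowski_closure_operator :: "'a set \<Rightarrow> ('a set \<Rightarrow> 'a set) \<Rightarrow> bool" where
  "kuratowski_closure_operator X c \<longleftrightarrow>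
     c \<in> Pow X \<rightarrow> Pow X \<and>
     c {} = {} \<and>
     (\<forall>A. A \<subseteq> X \<longrightarrow> A \<subseteq> c A) \<and>
     (\<forall>A B. A \<subseteq> X \<and> B \<subseteq> X \<longrightarrow> c (A \<union> B) = c A \<union> c B) \<and>
     (\<forall>A. A \<subseteq> X \<longrightarrow> c (c A) = c A)"

end

theory Submission
  imports Defs
begin

text \<open>
  The sets with complement outside the primal form a proper ideal, and
  \<open>diamond_R T P A\<close> is the local function of that ideal over the regular open sets:
  it collects the points all of whose regular open neighbourhoods meet \<open>A\<close> in a set
  not in the ideal. Since regular open sets are closed under finite intersection, the
  usual argument for ideal topological spaces applies.
\<close>

lemma regular_openin_topspace: "regular_openin T (topspace T)"
  by (simp add: regular_openin_def)

text \<open>An open set lies in the interior of its closure, which gives one inclusion; the other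
  follows by monotonicity of interior and closure applied to each factor.\<close>

lemma regular_openin_Int:
  assumes "regular_openin T U" "regular_openin T V"
  shows "regular_openin T (U \<inter> V)"
proof -
  have sub: "U \<subseteq> topspace T"
    and U: "U = T interior_of (T closure_of U)"
    and V: "V = T interior_of (T closure_of V)"
    using assms by (auto simp: regular_openin_def)
  have "openin T (U \<inter> V)"
    by (metis U V openin_Int openin_interior_of)
  then have "U \<inter> V \<subseteq> T interior_of (T closure_of (U \<inter> V))"
    by (simp add: closure_of_subset interior_of_maximal openin_subset)
  moreover have "T interior_of (T closure_of (U \<inter> V)) \<subseteq> U \<inter> V"
    using U V by (metis Int_greatest closure_of_mono inf_le1 inf_le2 interior_of_mono)
  ultimately show ?thesis
    using sub by (auto simp: regular_openin_def)
qed

lemma RO_at_Int: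
  "U \<in> RO_at T x \<Longrightarrow> V \<in> RO_at T x \<Longrightarrow> U \<inter> V \<in> RO_at T x"
  by (simp add: RO_at_def regular_openin_Int)

lemma topspace_in_RO_at: "x \<in> topspace T \<Longrightarrow> topspace T \<in> RO_at T x"
  by (simp add: RO_at_def regular_openin_topspace)

text \<open>De Morgan form of the definition: the condition now says that
  \<open>A \<inter> U\<close> is not in the ideal.\<close>

lemma diamond_R_iff:
  "x \<in> diamond_R T P A \<longleftrightarrow>
     x \<in> topspace T \<and> (\<forall>U \<in> RO_at T x. topspace T - A \<inter> U \<in> P)"
  by (simp add: diamond_R_def Diff_Int)

lemma diamond_R_subset_topspace: "diamond_R T P A \<subseteq> topspace T"
  by (auto simp: diamond_R_def)

context
  fixes T :: "'a topology" and P :: "'a set set"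
  assumes primal: "primal_topological_space T P"
begin

lemma topspace_notin_primal: "topspace T \<notin> P"
  using primal by (simp add: primal_topological_space_def primal_on_def)

lemma primal_subset: "A \<in> P \<Longrightarrow> B \<subseteq> A \<Longrightarrow> B \<in> P"
  using primal unfolding primal_topological_space_def primal_on_def by blast

text \<open>Contrapositive of the closure of the ideal under binary unions.\<close>

lemma primal_Diff_Un:
  assumes "topspace T - (A \<union> B) \<in> P"
  shows "topspace T - A \<in> P \<or> topspace T - B \<in> P"
proof -
  have "(topspace T - A) \<inter> (topspace T - B) \<in> P"
    using assms by (simp add: Diff_Un)
  then show ?thesis
    using primal unfolding primal_topological_space_def primal_on_def
    by (meson Diff_subset)
qed

lemma diamond_R_empty: "diamond_R T P {} = {}"
  \<comment> \<open>The neighbourhood \<open>topspace T\<close> already excludes every point, since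
    the complement of \<open>{}\<close> is the whole space.\<close>
  using topspace_in_RO_at topspace_notin_primal by (fastforce simp: diamond_R_iff)

lemma diamond_R_mono: "A \<subseteq> B \<Longrightarrow> diamond_R T P A \<subseteq> diamond_R T P B"
  unfolding subset_iff[of "diamond_R T P A"] diamond_R_iff
  by (meson Diff_mono Int_mono primal_subset subset_refl)

lemma diamond_R_Un: "diamond_R T P (A \<union> B) = diamond_R T P A \<union> diamond_R T P B"
proof
  show "diamond_R T P (A \<union> B) \<subseteq> diamond_R T P A \<union> diamond_R T P B"
  proof (rule subsetI, rule ccontr)
    fix x
    assume x: "x \<in> diamond_R T P (A \<union> B)" and "x \<notin> diamond_R T P A \<union> diamond_R T P B"
    then obtain U V where U: "U \<in> RO_at T x" "topspace T - A \<inter> U \<notin> P"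
      and V: "V \<in> RO_at T x" "topspace T - B \<inter> V \<notin> P"
      by (auto simp: diamond_R_iff)
    \<comment> \<open>The two failing neighbourhoods are merged into one, at which membership of
      \<open>x\<close> can be tested.\<close>
    have "topspace T - (A \<union> B) \<inter> (U \<inter> V) \<in> P"
      using x U(1) V(1) by (simp add: diamond_R_iff RO_at_Int)
    then have "topspace T - (A \<inter> U \<union> B \<inter> V) \<in> P"
      by (rule primal_subset) blast
    then show False
      using U(2) V(2) primal_Diff_Un by blast
  qed
qed (simp add: diamond_R_mono)

lemma diamond_R_diamond_R: "diamond_R T P (diamond_R T P A) \<subseteq> diamond_R T P A"
proof
  fix x
  assume x: "x \<in> diamond_R T P (diamond_R T P A)"
  have "topspace T - A \<inter> U \<in> P" if U: "U \<in> RO_at T x" for U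
  proof -
    have "topspace T - diamond_R T P A \<inter> U \<in> P"
      using x U by (simp add: diamond_R_iff)
    \<comment> \<open>Were the intersection empty, its complement would be the whole space, which is
      not in \<open>P\<close>.\<close>
    then obtain y where y: "y \<in> diamond_R T P A" "y \<in> U"
      using topspace_notin_primal by (metis Diff_empty disjoint_iff)
    \<comment> \<open>A regular open set is a neighbourhood of each of its points, so the condition
      on \<open>U\<close> can be read off at \<open>y\<close> instead of \<open>x\<close>.\<close>
    then have "U \<in> RO_at T y"
      using U by (simp add: RO_at_def)
    then show ?thesis
      using y by (simp add: diamond_R_iff)
  qed
  then show "x \<in> diamond_R T P A"
    using x by (simp add: diamond_R_iff)
qed

end

theorem corollary4p1p1:
  fixes T :: "'a topology" and P :: "'a set set"
  assumes "primal_topological_space T P"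
  shows "kuratowski_closure_operator (topspace T) (cl_diamond_R T P)"
  \<comment> \<open>By additivity, applying the operator twice adds only the iterated
    \<open>diamond_R\<close>, which is absorbed.\<close>
  using diamond_R_diamond_R[OF assms] diamond_R_subset_topspace[of T P]
  unfolding kuratowski_closure_operator_def cl_diamond_R_def
  by (auto simp: diamond_R_empty[OF assms] diamond_R_Un[OF assms])

end
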